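(* Let $R$ be a semisimple ring, and (by the Wedderburn–Artin theorem) identify $R$ with a direct product $\prod_{i=1}^k R_i$, where $R_i := \mathcal{M}_{n_i}(D_i)$, $k \ge 1$, $1 \le n_1 \le \cdots \le n_k$ are integers, and $D_1, \ldots, D_k$ are skew fields. Then the multiplicative submonoid $\mathcal{E}(R)$ of $R$ generated by the idempotents of $R$ is $$\mathcal{E}(R) = \prod_{i=1}^k R_i^\#.$$ Moreover, for every $x = (x_1, \ldots, x_k) \in \prod_{i=1}^k R_i^\#$, the minimum length $\ell(x)$ of an idempotent factorization of $x$ in $R$ satisfies $\ell(x) \le \max_{1 \le i \le k} \ell_i(x)$, where $\ell_i(x)$ is the minimum length of an idempotent factorization of $x_i$ in $R_i^\#$; in particular, $\ell(x) \le \max(n_1, \ldots, n_k) = n_k$.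
   Context: A ring (associative, non-zero, with identity) is semisimple if every right ideal is a direct summand of the right regular module. $\mathcal{M}_n(D)$ is the ring of $n$-by-$n$ matrices over $D$. For a ring $S$, $S^\#$ denotes the multiplicative submonoid of $S$ consisting of the identity $1_S$ and of all elements that are both left and right zero divisors of $S$. An idempotent factorization of an element is an expression of it as a finite product of idempotents (the empty product being the identity); its length is the number of factors. *)

theory Defs
  imports "HOL-Algebra.Algebra" "HOL-Library.Extended_Nat"
begin

definition skew_field :: "('a, 'm) ring_scheme \<Rightarrow> bool"
  where "skew_field D \<longleftrightarrow> ring D \<and> \<one>\<^bsub>D\<^esub> \<noteq> \<zero>\<^bsub>D\<^esub> \<and> Units D = carrier D - {\<zero>\<^bsub>D\<^esub>}"

definition right_ideal :: "'a set \<Rightarrow> ('a, 'm) ring_scheme \<Rightarrow> bool"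
  where "right_ideal I R \<longleftrightarrow>
    additive_subgroup I R \<and> (\<forall>a\<in>I. \<forall>r\<in>carrier R. a \<otimes>\<^bsub>R\<^esub> r \<in> I)"

text \<open>Right ideals are exactly the submodules of the right regular module, so a complement of
  \<open>I\<close> in that module is again a right ideal.\<close>

definition semisimple_ring :: "('a, 'm) ring_scheme \<Rightarrow> bool"
  where "semisimple_ring R \<longleftrightarrow> ring R \<and> \<one>\<^bsub>R\<^esub> \<noteq> \<zero>\<^bsub>R\<^esub> \<and>
    (\<forall>I. right_ideal I R \<longrightarrow>
      (\<exists>J. right_ideal J R \<and> I \<inter> J = {\<zero>\<^bsub>R\<^esub>} \<and> I <+>\<^bsub>R\<^esub> J = carrier R))"

text \<open>Matrices are functions on index pairs, extensional outside \<open>{1..n} \<times> {1..n}\<close> so that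
  equality of carrier elements is equality of entries.\<close>

definition mat_ring :: "nat \<Rightarrow> ('a, 'm) ring_scheme \<Rightarrow> (nat \<times> nat \<Rightarrow> 'a) ring"
  where "mat_ring n D =
    \<lparr> carrier = {1..n} \<times> {1..n} \<rightarrow>\<^sub>E carrier D,
      monoid.mult = (\<lambda>A B. \<lambda>(i, j) \<in> {1..n} \<times> {1..n}. \<Oplus>\<^bsub>D\<^esub>l\<in>{1..n}. A (i, l) \<otimes>\<^bsub>D\<^esub> B (l, j)),
      one = (\<lambda>(i, j) \<in> {1..n} \<times> {1..n}. if i = j then \<one>\<^bsub>D\<^esub> else \<zero>\<^bsub>D\<^esub>),
      ring.zero = (\<lambda>(i, j) \<in> {1..n} \<times> {1..n}. \<zero>\<^bsub>D\<^esub>),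
      ring.add = (\<lambda>A B. \<lambda>(i, j) \<in> {1..n} \<times> {1..n}. A (i, j) \<oplus>\<^bsub>D\<^esub> B (i, j)) \<rparr>"

text \<open>The ring analogue of \<^const>\<open>product_group\<close>.\<close>

definition product_ring :: "'i set \<Rightarrow> ('i \<Rightarrow> ('a, 'm) ring_scheme) \<Rightarrow> ('i \<Rightarrow> 'a) ring"
  where "product_ring I R =
    \<lparr> carrier = (\<Pi>\<^sub>E i\<in>I. carrier (R i)),
      monoid.mult = (\<lambda>x y. \<lambda>i\<in>I. x i \<otimes>\<^bsub>R i\<^esub> y i),
      one = (\<lambda>i\<in>I. \<one>\<^bsub>R i\<^esub>),
      ring.zero = (\<lambda>i\<in>I. \<zero>\<^bsub>R i\<^esub>),
      ring.add = (\<lambda>x y. \<lambda>i\<in>I. x i \<oplus>\<^bsub>R i\<^esub> y i) \<rparr>"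

text \<open>In a non-zero ring, zero itself counts as a zero divisor on both sides.\<close>

definition left_zero_divisor :: "('a, 'm) ring_scheme \<Rightarrow> 'a \<Rightarrow> bool"
  where "left_zero_divisor S a \<longleftrightarrow>
    a \<in> carrier S \<and> (\<exists>b\<in>carrier S. b \<noteq> \<zero>\<^bsub>S\<^esub> \<and> a \<otimes>\<^bsub>S\<^esub> b = \<zero>\<^bsub>S\<^esub>)"

definition right_zero_divisor :: "('a, 'm) ring_scheme \<Rightarrow> 'a \<Rightarrow> bool"
  where "right_zero_divisor S a \<longleftrightarrow>
    a \<in> carrier S \<and> (\<exists>b\<in>carrier S. b \<noteq> \<zero>\<^bsub>S\<^esub> \<and> b \<otimes>\<^bsub>S\<^esub> a = \<zero>\<^bsub>S\<^esub>)"

text \<open>The monoid \<open>S\<^sup>#\<close>; only the multiplicative structure of the resulting record is meaningful.\<close>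

definition sharp :: "('a, 'm) ring_scheme \<Rightarrow> ('a, 'm) ring_scheme"
  where "sharp S =
    S\<lparr>carrier := insert \<one>\<^bsub>S\<^esub> {a. left_zero_divisor S a \<and> right_zero_divisor S a}\<rparr>"

lemma submonoid_sharp:
  assumes "ring S"
  shows "submonoid (carrier (sharp S)) S"
proof -
  interpret ring S by fact
  have carr: "carrier (sharp S) =
      insert \<one>\<^bsub>S\<^esub> {a. left_zero_divisor S a \<and> right_zero_divisor S a}"
    by (simp add: sharp_def)
  have sub: "carrier (sharp S) \<subseteq> carrier S"
    unfolding carr left_zero_divisor_def by blast
  have "x \<otimes>\<^bsub>S\<^esub> y \<in> carrier (sharp S)"
    if x: "x \<in> carrier (sharp S)" and y: "y \<in> carrier (sharp S)" for x y
  proof (cases "x = \<one>\<^bsub>S\<^esub> \<or> y = \<one>\<^bsub>S\<^esub>")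
    case True
    with x y sub show ?thesis
      by (metis l_one r_one subsetD)
  next
    case False
    with x y have lr: "right_zero_divisor S x" "left_zero_divisor S y"
      unfolding carr by blast+
    then obtain b c where *: "x \<in> carrier S" "y \<in> carrier S"
      "b \<in> carrier S" "b \<noteq> \<zero>\<^bsub>S\<^esub>" "y \<otimes>\<^bsub>S\<^esub> b = \<zero>\<^bsub>S\<^esub>"
      "c \<in> carrier S" "c \<noteq> \<zero>\<^bsub>S\<^esub>" "c \<otimes>\<^bsub>S\<^esub> x = \<zero>\<^bsub>S\<^esub>"
      unfolding left_zero_divisor_def right_zero_divisor_def by blast
    have "(x \<otimes>\<^bsub>S\<^esub> y) \<otimes>\<^bsub>S\<^esub> b = \<zero>\<^bsub>S\<^esub>"
      using m_assoc[of x y b] * by simp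
    moreover have "c \<otimes>\<^bsub>S\<^esub> (x \<otimes>\<^bsub>S\<^esub> y) = \<zero>\<^bsub>S\<^esub>"
      using m_assoc[of c x y] * by simp
    ultimately have "left_zero_divisor S (x \<otimes>\<^bsub>S\<^esub> y)" "right_zero_divisor S (x \<otimes>\<^bsub>S\<^esub> y)"
      unfolding left_zero_divisor_def right_zero_divisor_def using * m_closed by blast+
    then show ?thesis
      by (simp add: carr)
  qed
  with sub show ?thesis
    by (simp add: submonoid_def carr)
qed

definition idempotents :: "('a, 'm) monoid_scheme \<Rightarrow> 'a set"
  where "idempotents M = {e \<in> carrier M. e \<otimes>\<^bsub>M\<^esub> e = e}"

definition idempotent_generated :: "('a, 'm) monoid_scheme \<Rightarrow> 'a set"
  where "idempotent_generated M = \<Inter>{H. submonoid H M \<and> idempotents M \<subseteq> H}"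

definition idempotent_factorizations :: "('a, 'm) monoid_scheme \<Rightarrow> 'a \<Rightarrow> 'a list set"
  where "idempotent_factorizations M x =
    {es. set es \<subseteq> idempotents M \<and> foldr (\<otimes>\<^bsub>M\<^esub>) es \<one>\<^bsub>M\<^esub> = x}"

text \<open>Infinite if there is no idempotent factorization at all.\<close>

definition idempotent_length :: "('a, 'm) monoid_scheme \<Rightarrow> 'a \<Rightarrow> enat"
  where "idempotent_length M x = (INF es\<in>idempotent_factorizations M x. enat (length es))"

end

theory Submission
  imports Defs
begin

text \<open>Let \<open>A\<close> be a singular matrix over a skew field that is not idempotent. Pick \<open>v \<noteq> 0\<close> with
  \<open>A v = 0\<close> and \<open>x = A y\<close> with \<open>A x \<noteq> x\<close>. After rescaling \<open>v\<close> and \<open>y\<close> there is a linear form \<open>f\<close>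
  vanishing on the kernel of \<open>1 - A\<close> with \<open>f v = f x = 1\<close>. Put \<open>w = (1 - A) x\<close>, \<open>E = 1 - v f\<close> and
  \<open>B = A + w f\<close>. Then \<open>E\<close> is idempotent, \<open>A = B E\<close>, \<open>B\<close> is singular because its image lies in that
  of \<open>A\<close>, and \<open>1 - B = (1 - A) (1 - x f)\<close> has smaller rank than \<open>1 - A\<close>. Hence \<open>A\<close> is a product of
  at most \<open>rank (1 - A) \<le> n\<close> idempotents. In a direct product, factorizations of the components are
  combined after padding with ones. Conversely, an idempotent \<open>e \<noteq> 1\<close> is a two-sided zero divisor
  because of \<open>e (1 - e) = (1 - e) e = 0\<close>.\<close>

section \<open>Products of idempotents in rings with matrix units\<close>

lemma (in ring) diff_l_distr:
  assumes "a \<in> carrier R" "b \<in> carrier R" "c \<in> carrier R"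
  shows "(a \<ominus> b) \<otimes> c = a \<otimes> c \<ominus> b \<otimes> c"
  using assms by (simp add: minus_eq l_distr l_minus)

lemma (in ring) diff_r_distr:
  assumes "a \<in> carrier R" "b \<in> carrier R" "c \<in> carrier R"
  shows "c \<otimes> (a \<ominus> b) = c \<otimes> a \<ominus> c \<otimes> b"
  using assms by (simp add: minus_eq r_distr r_minus)

lemma (in ring) diff_self: "a \<in> carrier R \<Longrightarrow> a \<ominus> a = \<zero>"
  by (simp add: minus_eq r_neg)

lemma (in ring) diff_zero: "a \<in> carrier R \<Longrightarrow> a \<ominus> \<zero> = a"
  by (simp add: minus_eq)

lemma (in ring) one_minus_idempotent:
  assumes "x \<in> carrier R" "x \<otimes> x = x"
  shows "\<one> \<ominus> x \<in> idempotents R"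
proof -
  have "(\<one> \<ominus> x) \<otimes> (\<one> \<ominus> x) = \<one> \<ominus> x"
    using assms by (simp add: diff_l_distr diff_r_distr diff_self diff_zero)
  with assms show ?thesis by (simp add: idempotents_def)
qed

lemma (in monoid) foldr_mult_closed:
  "set xs \<subseteq> carrier G \<Longrightarrow> foldr (\<otimes>) xs \<one> \<in> carrier G"
  by (induction xs) auto

text \<open>The rank induction splits off its idempotent on the right, whereas \<open>foldr\<close>
  unfolds lists from the left.\<close>

lemma (in monoid) foldr_mult_snoc:
  assumes "set xs \<subseteq> carrier G" "x \<in> carrier G"
  shows "foldr (\<otimes>) (xs @ [x]) \<one> = foldr (\<otimes>) xs \<one> \<otimes> x"
  using assms by (induction xs) (auto simp: m_assoc foldr_mult_closed)

lemma idempotents_subset_carrier: "idempotents M \<subseteq> carrier M"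
  by (auto simp: idempotents_def)

text \<open>The elements \<open>r s\<close> and \<open>c s\<close> play the roles of the matrix units \<open>E\<^sub>1\<^sub>s\<close> and \<open>E\<^sub>s\<^sub>1\<close>: an
  element \<open>v\<close> with \<open>v \<otimes> e = v\<close> is a column vector, and the corner \<open>e R e\<close> is the skew field of
  scalars.\<close>

locale matrix_units = ring R for R (structure) +
  fixes I :: "'i set" and r c :: "'i \<Rightarrow> 'a" and e :: 'a
  assumes finite_I: "finite I"
    and e_closed [simp]: "e \<in> carrier R"
    and r_closed [simp]: "s \<in> I \<Longrightarrow> r s \<in> carrier R"
    and c_closed [simp]: "s \<in> I \<Longrightarrow> c s \<in> carrier R"
    and e_r: "s \<in> I \<Longrightarrow> e \<otimes> r s = r s"
    and c_e: "s \<in> I \<Longrightarrow> c s \<otimes> e = c s"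
    and r_c: "s \<in> I \<Longrightarrow> t \<in> I \<Longrightarrow> r s \<otimes> c t = (if s = t then e else \<zero>)"
    and rows_eq_zero: "x \<in> carrier R \<Longrightarrow> (\<And>s. s \<in> I \<Longrightarrow> r s \<otimes> x = \<zero>) \<Longrightarrow> x = \<zero>"
    and columns_eq_zero: "x \<in> carrier R \<Longrightarrow> (\<And>s. s \<in> I \<Longrightarrow> x \<otimes> c s = \<zero>) \<Longrightarrow> x = \<zero>"
    and corner_inverse: "d \<in> carrier R \<Longrightarrow> d \<noteq> \<zero> \<Longrightarrow> e \<otimes> d = d \<Longrightarrow> d \<otimes> e = d \<Longrightarrow>
      \<exists>d'\<in>carrier R. d' \<otimes> e = d' \<and> d \<otimes> d' = e"
begin

text \<open>\<open>supported J Q\<close>: all rows of \<open>Q\<close> outside \<open>J\<close> vanish, so \<open>P \<otimes> Q\<close> has rank at most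
  \<open>card J\<close>.\<close>

definition supported :: "'i set \<Rightarrow> 'a \<Rightarrow> bool"
  where "supported J Q \<longleftrightarrow> Q \<in> carrier R \<and> (\<forall>s\<in>I - J. r s \<otimes> Q = \<zero>)"

text \<open>With \<open>x = A \<otimes> y\<close> and \<open>f\<close> row \<open>p\<close> of
  \<open>Q\<close>, multiplying \<open>Q\<close> on the right by
  \<open>\<one> \<ominus> x \<otimes> f\<close> turns row \<open>p\<close> into
  \<open>f \<ominus> (f \<otimes> x) \<otimes> f = \<zero>\<close> and keeps vanishing rows zero. So
  the support loses \<open>p\<close>, while \<open>B\<close> has a kernel vector again and the step
  can be repeated.\<close>

lemma peel_idempotent:
  assumes A [simp]: "A \<in> carrier R" and P [simp]: "P \<in> carrier R"
    and PQ: "\<one> \<ominus> A = P \<otimes> Q" and Q: "supported J Q"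
    and p: "p \<in> I" and v [simp]: "v \<in> carrier R" and y [simp]: "y \<in> carrier R"
    and v0: "v \<noteq> \<zero>" and Av: "A \<otimes> v = \<zero>" and ve: "v \<otimes> e = v" and ye: "y \<otimes> e = y"
    and fx: "r p \<otimes> Q \<otimes> (A \<otimes> y) = e" and fv: "r p \<otimes> Q \<otimes> v = e"
  obtains E B Q' b where "E \<in> idempotents R" "B \<in> carrier R" "A = B \<otimes> E"
    "\<one> \<ominus> B = P \<otimes> Q'" "supported (J - {p}) Q'" "b \<in> carrier R" "b \<noteq> \<zero>" "B \<otimes> b = \<zero>"
proof -
  have Qc [simp]: "Q \<in> carrier R" using Q by (simp add: supported_def)
  define f where "f = r p \<otimes> Q"
  have f [simp]: "f \<in> carrier R" by (simp add: f_def p)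
  have ef: "e \<otimes> f = f" by (simp add: f_def p e_r flip: m_assoc)
  define x where "x = A \<otimes> y"
  have x [simp]: "x \<in> carrier R" by (simp add: x_def)
  have fx: "f \<otimes> x = e" and fv: "f \<otimes> v = e" using fx fv by (simp_all add: f_def x_def)
  define z where "z = y \<ominus> x"
  have z [simp]: "z \<in> carrier R" by (simp add: z_def)
  define w where "w = A \<otimes> z"
  have w [simp]: "w \<in> carrier R" by (simp add: w_def)
  have xe: "x \<otimes> e = x" by (simp add: x_def m_assoc ye)
  have we: "w \<otimes> e = w" by (simp add: w_def z_def m_assoc diff_l_distr xe ye)
  \<comment> \<open>\<open>A\<close> commutes with \<open>\<one> \<ominus> A\<close>. The form
    \<open>A \<otimes> z\<close> places \<open>w\<close> in the image of \<open>A\<close>, which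
    makes \<open>B\<close> singular; the new form gives
    \<open>w = P \<otimes> Q \<otimes> x\<close>, which makes \<open>\<one> \<ominus> B\<close>
    factor through \<open>P\<close>.\<close>
  have w_alt: "w = (\<one> \<ominus> A) \<otimes> x"
    by (simp add: w_def z_def diff_l_distr diff_r_distr) (simp add: x_def)
  have fvu: "f \<otimes> (v \<otimes> u) = e \<otimes> u" if "u \<in> carrier R" for u
    using that by (simp add: fv flip: m_assoc)
  have Avu: "A \<otimes> (v \<otimes> u) = \<zero>" if "u \<in> carrier R" for u
    using that by (simp add: Av flip: m_assoc)
  define E where "E = \<one> \<ominus> v \<otimes> f"
  define B where "B = A \<oplus> w \<otimes> f"
  define Q' where "Q' = Q \<ominus> Q \<otimes> x \<otimes> f"
  \<comment> \<open>A kernel vector of \<open>B\<close>: subtracting multiples of \<open>v\<close>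
    from \<open>z\<close> does not change the image \<open>A \<otimes> z = w\<close>, and these
    multiples are tuned so that \<open>f \<otimes> b = \<ominus> e\<close>. Then
    \<open>B \<otimes> b = w \<ominus> w \<otimes> e = \<zero>\<close>, and \<open>b\<close> is
    nonzero because \<open>e\<close> is.\<close>
  define b where "b = z \<ominus> v \<otimes> (f \<otimes> z) \<ominus> v"
  show thesis
  proof
    show "E \<in> idempotents R"
      unfolding E_def by (rule one_minus_idempotent) (simp_all add: m_assoc fvu ef)
    \<comment> \<open>As \<open>f \<otimes> v = e\<close>, the form \<open>f\<close> vanishes on the
      image of \<open>E\<close>, so the correction \<open>w \<otimes> f\<close> disappears in
      \<open>B \<otimes> E\<close>.\<close>
    have fE: "f \<otimes> E = \<zero>"
      by (simp add: E_def diff_r_distr fvu ef diff_self)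
    have "A \<otimes> E = A"
      by (simp add: E_def diff_r_distr Avu diff_zero)
    moreover have [simp]: "E \<in> carrier R" by (simp add: E_def)
    ultimately show "A = B \<otimes> E"
      by (simp add: B_def l_distr m_assoc fE)
    have "P \<otimes> Q' = P \<otimes> Q \<ominus> P \<otimes> Q \<otimes> x \<otimes> f"
      by (simp add: Q'_def diff_r_distr m_assoc)
    also have "\<dots> = \<one> \<ominus> A \<ominus> w \<otimes> f"
      by (simp add: w_alt flip: PQ)
    also have "\<dots> = \<one> \<ominus> B"
      by (simp add: B_def minus_eq minus_add a_assoc)
    finally show "\<one> \<ominus> B = P \<otimes> Q'" ..
    have "r s \<otimes> Q' = \<zero>" if s: "s \<in> I - (J - {p})" for s
    proof -
      have "r s \<otimes> Q' = r s \<otimes> Q \<ominus> r s \<otimes> Q \<otimes> x \<otimes> f"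
        using s by (simp add: Q'_def diff_r_distr m_assoc)
      also have "\<dots> = \<zero>"
      proof (cases "s = p")
        case True
        then show ?thesis by (simp add: ef fx diff_self flip: f_def)
      next
        case False
        then have "r s \<otimes> Q = \<zero>" using s Q by (auto simp: supported_def)
        then show ?thesis by (simp add: diff_zero)
      qed
      finally show ?thesis .
    qed
    then show "supported (J - {p}) Q'" by (simp add: supported_def Q'_def)
    show bc: "b \<in> carrier R" by (simp add: b_def)
    have efz: "e \<otimes> (f \<otimes> z) = f \<otimes> z" by (simp add: ef flip: m_assoc)
    have fb: "f \<otimes> b = \<ominus> e"
      by (simp add: b_def diff_r_distr fvu fv efz diff_self) (simp add: minus_eq)
    have "e \<noteq> \<zero>" using v0 ve by auto
    then show "b \<noteq> \<zero>" using fb by (metis f e_closed minus_minus minus_zero r_null)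
    have "A \<otimes> b = w"
      by (simp add: b_def diff_r_distr Avu Av diff_zero flip: w_def)
    then show "B \<otimes> b = \<zero>"
      using bc by (simp add: B_def l_distr m_assoc fb r_minus we r_neg)
    show "B \<in> carrier R" by (simp add: B_def)
  qed
qed

text \<open>A row applied to a column gives an element of the corner \<open>e R e\<close>; when
  nonzero it has a right inverse relative to \<open>e\<close>, by which the column can be
  rescaled.\<close>

lemma nonzero_row_normalize:
  assumes "u \<in> carrier R" "u \<otimes> e = u" "s \<in> I" "Q \<in> carrier R" "r s \<otimes> Q \<otimes> u \<noteq> \<zero>"
  obtains d where "d \<in> carrier R" "d \<otimes> e = d" "r s \<otimes> Q \<otimes> (u \<otimes> d) = e"
proof -
  have "e \<otimes> (r s \<otimes> Q \<otimes> u) = r s \<otimes> Q \<otimes> u"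
    using assms by (simp add: e_r flip: m_assoc)
  moreover have "r s \<otimes> Q \<otimes> u \<otimes> e = r s \<otimes> Q \<otimes> u"
    using assms by (simp add: m_assoc)
  ultimately obtain d where "d \<in> carrier R" "d \<otimes> e = d" "r s \<otimes> Q \<otimes> u \<otimes> d = e"
    using corner_inverse[of "r s \<otimes> Q \<otimes> u"] assms by auto
  then show thesis
    using that assms by (simp add: m_assoc)
qed

text \<open>A nonzero column \<open>Q \<otimes> u\<close> has a nonzero coordinate, and its
  coordinates outside \<open>J\<close> vanish.\<close>

lemma supported_row:
  assumes "supported J Q" "J \<subseteq> I" "u \<in> carrier R" "Q \<otimes> u \<noteq> \<zero>"
  obtains s where "s \<in> J" "r s \<otimes> Q \<otimes> u \<noteq> \<zero>"
proof -
  have Q: "Q \<in> carrier R" using assms by (simp add: supported_def)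
  obtain s where s: "s \<in> I" "r s \<otimes> (Q \<otimes> u) \<noteq> \<zero>"
    using rows_eq_zero[of "Q \<otimes> u"] assms Q by auto
  then have *: "r s \<otimes> Q \<otimes> u \<noteq> \<zero>" using assms Q by (simp add: m_assoc)
  then have "r s \<otimes> Q \<noteq> \<zero>" using assms(3) by auto
  then have "s \<in> J" using s assms(1) by (auto simp: supported_def)
  with * that show thesis by blast
qed

text \<open>Choosing a row \<open>p\<close> that takes the value \<open>e\<close> on multiples of both vectors. If no single row is
  nonzero on both, adding row \<open>q\<close> to row \<open>p\<close> (and compensating in \<open>P\<close>) creates one.\<close>

lemma common_row:
  assumes P: "P \<in> carrier R" and Q: "supported J Q" and J: "J \<subseteq> I"
    and x: "x \<in> carrier R" "x \<otimes> e = x" "Q \<otimes> x \<noteq> \<zero>"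
    and v: "v \<in> carrier R" "v \<otimes> e = v" "Q \<otimes> v \<noteq> \<zero>"
  obtains p P' Q' a b where "p \<in> J" "P' \<in> carrier R" "supported J Q'" "P' \<otimes> Q' = P \<otimes> Q"
    "a \<in> carrier R" "a \<otimes> e = a" "r p \<otimes> Q' \<otimes> (x \<otimes> a) = e"
    "b \<in> carrier R" "b \<otimes> e = b" "r p \<otimes> Q' \<otimes> (v \<otimes> b) = e"
proof -
  have Qc: "Q \<in> carrier R" using Q by (simp add: supported_def)
  obtain p where p: "p \<in> J" "r p \<otimes> Q \<otimes> x \<noteq> \<zero>" using supported_row[OF Q J x(1,3)] .
  obtain q where q: "q \<in> J" "r q \<otimes> Q \<otimes> v \<noteq> \<zero>" using supported_row[OF Q J v(1,3)] .
  have pI: "p \<in> I" and qI: "q \<in> I" using p q J by auto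
  \<comment> \<open>\<open>p\<close> was chosen for \<open>x\<close> and \<open>q\<close> for
    \<open>v\<close>. If one of these rows also serves the other vector, \<open>P\<close> and
    \<open>Q\<close> are kept; otherwise both cross values are zero.\<close>
  consider "r p \<otimes> Q \<otimes> v \<noteq> \<zero>" | "r q \<otimes> Q \<otimes> x \<noteq> \<zero>"
    | "r p \<otimes> Q \<otimes> v = \<zero>" "r q \<otimes> Q \<otimes> x = \<zero>" by blast
  then show thesis
  proof cases
    case 1
    obtain a where "a \<in> carrier R" "a \<otimes> e = a" "r p \<otimes> Q \<otimes> (x \<otimes> a) = e"
      using nonzero_row_normalize[OF x(1,2) pI Qc p(2)] .
    moreover obtain b where "b \<in> carrier R" "b \<otimes> e = b" "r p \<otimes> Q \<otimes> (v \<otimes> b) = e"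
      using nonzero_row_normalize[OF v(1,2) pI Qc 1] .
    ultimately show thesis using that p(1) P Q by blast
  next
    case 2
    obtain a where "a \<in> carrier R" "a \<otimes> e = a" "r q \<otimes> Q \<otimes> (x \<otimes> a) = e"
      using nonzero_row_normalize[OF x(1,2) qI Qc 2] .
    moreover obtain b where "b \<in> carrier R" "b \<otimes> e = b" "r q \<otimes> Q \<otimes> (v \<otimes> b) = e"
      using nonzero_row_normalize[OF v(1,2) qI Qc q(2)] .
    ultimately show thesis using that q(1) P Q by blast
  next
    case 3
    have pq: "p \<noteq> q" using 3 p by auto
    \<comment> \<open>The matrix unit \<open>E\<^sub>p\<^sub>q\<close>. Its square is zero because
      \<open>p \<noteq> q\<close>, so \<open>\<one> \<oplus> T\<close> has inverse
      \<open>\<one> \<ominus> T\<close>; left multiplication by \<open>\<one> \<oplus> T\<close>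
      adds row \<open>q\<close> to row \<open>p\<close>.\<close>
    define T where "T = c p \<otimes> r q"
    have T [simp]: "T \<in> carrier R" using pI qI by (simp add: T_def)
    have "T \<otimes> T = c p \<otimes> (r q \<otimes> c p) \<otimes> r q" using pI qI by (simp add: T_def m_assoc)
    then have TT: "T \<otimes> T = \<zero>" using pI qI pq by (simp add: r_c)
    have rT: "r s \<otimes> T = (if s = p then r q else \<zero>)" if "s \<in> I" for s
    proof -
      have "r s \<otimes> T = (r s \<otimes> c p) \<otimes> r q" using pI qI that by (simp add: T_def m_assoc)
      then show ?thesis using pI qI that by (simp add: r_c e_r)
    qed
    define P' where "P' = P \<otimes> (\<one> \<ominus> T)"
    define Q' where "Q' = (\<one> \<oplus> T) \<otimes> Q"
    have Q'c: "Q' \<in> carrier R" using Qc by (simp add: Q'_def)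
    have rQ': "r s \<otimes> Q' = (if s = p then r p \<otimes> Q \<oplus> r q \<otimes> Q else r s \<otimes> Q)" if "s \<in> I" for s
    proof -
      have "r s \<otimes> Q' = (r s \<oplus> r s \<otimes> T) \<otimes> Q"
        using that Qc by (simp add: Q'_def r_distr flip: m_assoc)
      then show ?thesis using that pI qI Qc by (simp add: rT l_distr)
    qed
    have "supported J Q'" using Q p Q'c by (auto simp: supported_def rQ')
    moreover have "P' \<otimes> Q' = P \<otimes> ((\<one> \<ominus> T) \<otimes> (\<one> \<oplus> T)) \<otimes> Q"
      using P Qc by (simp add: P'_def Q'_def m_assoc)
    moreover have "(\<one> \<ominus> T) \<otimes> (\<one> \<oplus> T) = \<one>"
      by (simp add: diff_l_distr r_distr TT) (simp add: minus_eq a_assoc l_neg)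
    \<comment> \<open>Since the cross values vanish, the summed row takes on \<open>x\<close> the
      value of row \<open>p\<close> and on \<open>v\<close> that of row \<open>q\<close>, both
      nonzero.\<close>
    moreover have "r p \<otimes> Q' \<otimes> x \<noteq> \<zero>"
      using pI qI Qc x p 3 by (simp add: rQ' l_distr)
    then obtain a where "a \<in> carrier R" "a \<otimes> e = a" "r p \<otimes> Q' \<otimes> (x \<otimes> a) = e"
      using nonzero_row_normalize[OF x(1,2) pI Q'c] by blast
    moreover have "r p \<otimes> Q' \<otimes> v \<noteq> \<zero>"
      using pI qI Qc v q 3 by (simp add: rQ' l_distr)
    then obtain b where "b \<in> carrier R" "b \<otimes> e = b" "r p \<otimes> Q' \<otimes> (v \<otimes> b) = e"
      using nonzero_row_normalize[OF v(1,2) pI Q'c] by blast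
    moreover have "P' \<in> carrier R" using P by (simp add: P'_def)
    ultimately show thesis using that p(1) P by simp
  qed
qed

text \<open>Induction on \<open>card J\<close>, which bounds the rank of
  \<open>\<one> \<ominus> A\<close>. Peeling replaces \<open>A\<close> by another element with its
  own kernel vector and factorization, so \<open>A\<close>, \<open>P\<close>, \<open>Q\<close> and
  \<open>b\<close> all vary.\<close>

lemma factorization_of_rank_le:
  assumes "J \<subseteq> I" "A \<in> carrier R" "P \<in> carrier R" "supported J Q" "\<one> \<ominus> A = P \<otimes> Q"
    and "b \<in> carrier R" "b \<noteq> \<zero>" "A \<otimes> b = \<zero>"
  shows "\<exists>es\<in>idempotent_factorizations R A. length es \<le> card J"
  using assms
proof (induction "card J" arbitrary: J A P Q b)
  case 0
  then have "J = {}" using finite_I by (simp add: finite_subset)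
  then have "Q = \<zero>" using 0(5) rows_eq_zero[of Q] by (simp add: supported_def)
  then have "\<one> \<ominus> A = \<zero>" using 0 by simp
  then have "A = \<one>" using 0 by simp
  then show ?case by (intro bexI[of _ "[]"]) (auto simp: idempotent_factorizations_def)
next
  case (Suc k)
  note A [simp] = \<open>A \<in> carrier R\<close> and P = \<open>P \<in> carrier R\<close>
  have Q: "Q \<in> carrier R" using Suc.prems(4) by (simp add: supported_def)
  show ?case
  proof (cases "A \<otimes> A = A")
    case True
    then have "[A] \<in> idempotent_factorizations R A"
      by (simp add: idempotent_factorizations_def idempotents_def)
    \<comment> \<open>The single factor fits the bound because \<open>card J\<close> is a successor
      here.\<close>
    then show ?thesis using Suc.hyps(2) by (intro bexI[of _ "[A]"]) auto
  next
    case False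
    then have "A \<ominus> A \<otimes> A \<noteq> \<zero>" by simp
    \<comment> \<open>Column \<open>t\<close> of \<open>A \<ominus> A \<otimes> A\<close> is
      nonzero, so column \<open>x\<close> of \<open>A\<close> satisfies
      \<open>(\<one> \<ominus> A) \<otimes> x \<noteq> \<zero>\<close>. Up to a scalar,
      \<open>c t\<close> becomes the vector \<open>y\<close> of the peeling step.\<close>
    then obtain t where t: "t \<in> I" "(A \<ominus> A \<otimes> A) \<otimes> c t \<noteq> \<zero>"
      using columns_eq_zero[of "A \<ominus> A \<otimes> A"] by auto
    define x where "x = A \<otimes> c t"
    have x: "x \<in> carrier R" "x \<otimes> e = x" using t by (simp_all add: x_def m_assoc c_e)
    have "P \<otimes> (Q \<otimes> x) = (\<one> \<ominus> A) \<otimes> x" using P Q x Suc.prems(5) by (simp add: m_assoc)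
    also have "\<dots> = (A \<ominus> A \<otimes> A) \<otimes> c t"
      using t by (simp add: x_def diff_l_distr m_assoc)
    finally have Qx: "Q \<otimes> x \<noteq> \<zero>" using t P by auto
    \<comment> \<open>\<open>b\<close> is an arbitrary element annihilated by \<open>A\<close>; a
      nonzero column of it is a kernel vector.\<close>
    obtain s where s: "s \<in> I" "b \<otimes> c s \<noteq> \<zero>"
      using columns_eq_zero[of b] Suc.prems by auto
    define v where "v = b \<otimes> c s"
    have v: "v \<in> carrier R" "v \<otimes> e = v" and v0: "v \<noteq> \<zero>"
      using s Suc.prems by (simp_all add: v_def m_assoc c_e)
    have "A \<otimes> v = A \<otimes> b \<otimes> c s" using s Suc.prems by (simp add: v_def flip: m_assoc)
    then have Av: "A \<otimes> v = \<zero>" using Suc.prems s by simp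
    \<comment> \<open>On the kernel of \<open>A\<close> the element
      \<open>\<one> \<ominus> A\<close> acts as the identity, so \<open>Q\<close> cannot annihilate
      \<open>v\<close>.\<close>
    have "P \<otimes> (Q \<otimes> v) = (\<one> \<ominus> A) \<otimes> v" using P Q v Suc.prems(5) by (simp add: m_assoc)
    also have "\<dots> = v" using v by (simp add: diff_l_distr Av diff_zero)
    finally have Qv: "Q \<otimes> v \<noteq> \<zero>" using v0 P by auto
    obtain p P' Q' \<alpha> \<beta> where p: "p \<in> J" and P': "P' \<in> carrier R" and Q': "supported J Q'"
      and PQ: "P' \<otimes> Q' = P \<otimes> Q"
      and \<alpha>: "\<alpha> \<in> carrier R" "\<alpha> \<otimes> e = \<alpha>" "r p \<otimes> Q' \<otimes> (x \<otimes> \<alpha>) = e"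
      and \<beta>: "\<beta> \<in> carrier R" "\<beta> \<otimes> e = \<beta>" "r p \<otimes> Q' \<otimes> (v \<otimes> \<beta>) = e"
      using common_row[OF P Suc.prems(4,1) x Qx v Qv] .
    have pI: "p \<in> I" using p Suc.prems(1) by auto
    have Q'c: "Q' \<in> carrier R" using Q' by (simp add: supported_def)
    have "e \<noteq> \<zero>" using v0 v by auto
    then have v\<beta>: "v \<otimes> \<beta> \<noteq> \<zero>" using \<beta> Q'c pI by (metis r_closed m_closed r_null)
    have PQ': "\<one> \<ominus> A = P' \<otimes> Q'" using PQ Suc.prems(5) by simp
    have Av\<beta>: "A \<otimes> (v \<otimes> \<beta>) = \<zero>" using v \<beta> Av by (simp flip: m_assoc)
    have fx: "r p \<otimes> Q' \<otimes> (A \<otimes> (c t \<otimes> \<alpha>)) = e"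
      using \<alpha> t by (simp add: x_def m_assoc)
    obtain E B Q'' b' where *: "E \<in> idempotents R" "B \<in> carrier R" "A = B \<otimes> E"
      "\<one> \<ominus> B = P' \<otimes> Q''" "supported (J - {p}) Q''" "b' \<in> carrier R" "b' \<noteq> \<zero>" "B \<otimes> b' = \<zero>"
      by (rule peel_idempotent[OF A P' PQ' Q' pI _ _ v\<beta> Av\<beta> _ _ fx \<beta>(3)])
        (use v(1) \<alpha>(1,2) \<beta>(1,2) t(1) in \<open>simp_all add: m_assoc\<close>)
    have fin: "finite J" using Suc.prems(1) finite_I finite_subset by blast
    then have k: "k = card (J - {p})" using p Suc.hyps(2) by simp
    have sub: "J - {p} \<subseteq> I" using Suc.prems(1) by auto
    obtain es where es: "es \<in> idempotent_factorizations R B" "length es \<le> card (J - {p})"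
      using Suc.hyps(1)[OF k sub *(2) P' *(5,4,6,7,8)] by blast
    have es_idem: "set es \<subseteq> idempotents R" and es_B: "foldr (\<otimes>) es \<one> = B"
      using es(1) by (simp_all add: idempotent_factorizations_def)
    have "foldr (\<otimes>) (es @ [E]) \<one> = B \<otimes> E"
      unfolding es_B[symmetric]
      using es_idem *(1) idempotents_subset_carrier[of R] by (intro foldr_mult_snoc) auto
    then have "es @ [E] \<in> idempotent_factorizations R A"
      using es_idem *(1,3) unfolding idempotent_factorizations_def by simp
    moreover have "length (es @ [E]) \<le> card J"
      using es(2) p fin Suc.hyps(2) by simp
    ultimately show ?thesis by blast
  qed
qed

text \<open>The induction starts with all rows: \<open>P = \<one> \<ominus> A\<close> and
  \<open>Q = \<one>\<close>, for which the condition on rows outside \<open>I\<close> is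
  vacuous.\<close>

lemma left_zero_divisor_factorization:
  assumes "left_zero_divisor R A"
  shows "\<exists>es\<in>idempotent_factorizations R A. length es \<le> card I"
proof -
  obtain b where "A \<in> carrier R" "b \<in> carrier R" "b \<noteq> \<zero>" "A \<otimes> b = \<zero>"
    using assms by (auto simp: left_zero_divisor_def)
  then show ?thesis
    by (intro factorization_of_rank_le[of I A "\<one> \<ominus> A" \<one> b]) (auto simp: supported_def)
qed

end

section \<open>Matrix rings\<close>

text \<open>Serves the associativity of the matrix product.\<close>

lemma (in abelian_monoid) finsum_swap:
  assumes "finite A" "finite B" "\<And>i j. i \<in> A \<Longrightarrow> j \<in> B \<Longrightarrow> f i j \<in> carrier G"
  shows "(\<Oplus>i\<in>A. \<Oplus>j\<in>B. f i j) = (\<Oplus>j\<in>B. \<Oplus>i\<in>A. f i j)"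
  using assms(1,3)
proof (induction A)
  case empty
  then show ?case by simp
next
  case (insert a A)
  have "(\<Oplus>i\<in>insert a A. \<Oplus>j\<in>B. f i j) = (\<Oplus>j\<in>B. f a j) \<oplus> (\<Oplus>j\<in>B. \<Oplus>i\<in>A. f i j)"
    using insert by (subst finsum_insert) (auto intro!: finsum_closed)
  also have "\<dots> = (\<Oplus>j\<in>B. f a j \<oplus> (\<Oplus>i\<in>A. f i j))"
    using insert.prems by (intro finsum_addf[symmetric]) (auto intro!: finsum_closed)
  also have "\<dots> = (\<Oplus>j\<in>B. \<Oplus>i\<in>insert a A. f i j)"
    using insert by (intro finsum_cong') (auto intro!: finsum_closed)
  finally show ?case .
qed

section \<open>Entries of matrices\<close>

lemma mat_eqI:
  assumes "A \<in> carrier (mat_ring n D)" "B \<in> carrier (mat_ring n D)"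
    and "\<And>i j. i \<in> {1..n} \<Longrightarrow> j \<in> {1..n} \<Longrightarrow> A (i, j) = B (i, j)"
  shows "A = B"
  using assms by (intro PiE_ext[of A "{1..n} \<times> {1..n}" _ B]) (auto simp: mat_ring_def)

lemma mat_entry_closed:
  "A \<in> carrier (mat_ring n D) \<Longrightarrow> i \<in> {1..n} \<Longrightarrow> j \<in> {1..n} \<Longrightarrow> A (i, j) \<in> carrier D"
  by (auto simp: mat_ring_def)

lemma mat_mult_entry:
  "i \<in> {1..n} \<Longrightarrow> j \<in> {1..n} \<Longrightarrow>
    (A \<otimes>\<^bsub>mat_ring n D\<^esub> B) (i, j) = (\<Oplus>\<^bsub>D\<^esub>l\<in>{1..n}. A (i, l) \<otimes>\<^bsub>D\<^esub> B (l, j))"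
  by (simp add: mat_ring_def)

lemma mat_add_entry:
  "i \<in> {1..n} \<Longrightarrow> j \<in> {1..n} \<Longrightarrow>
    (A \<oplus>\<^bsub>mat_ring n D\<^esub> B) (i, j) = A (i, j) \<oplus>\<^bsub>D\<^esub> B (i, j)"
  by (simp add: mat_ring_def)

lemma mat_one_entry:
  "i \<in> {1..n} \<Longrightarrow> j \<in> {1..n} \<Longrightarrow>
    \<one>\<^bsub>mat_ring n D\<^esub> (i, j) = (if i = j then \<one>\<^bsub>D\<^esub> else \<zero>\<^bsub>D\<^esub>)"
  by (simp add: mat_ring_def)

lemma mat_zero_entry:
  "i \<in> {1..n} \<Longrightarrow> j \<in> {1..n} \<Longrightarrow> \<zero>\<^bsub>mat_ring n D\<^esub> (i, j) = \<zero>\<^bsub>D\<^esub>"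
  by (simp add: mat_ring_def)

text \<open>The multiple \<open>a E\<^sub>s\<^sub>t\<close> of a matrix unit, extensional like the
  elements of \<open>mat_ring\<close>.\<close>

definition mat_unit :: "nat \<Rightarrow> ('a, 'm) ring_scheme \<Rightarrow> nat \<Rightarrow> nat \<Rightarrow> 'a \<Rightarrow> nat \<times> nat \<Rightarrow> 'a"
  where "mat_unit n D s t a =
    (\<lambda>(i, j) \<in> {1..n} \<times> {1..n}. if i = s \<and> j = t then a else \<zero>\<^bsub>D\<^esub>)"

lemma mat_unit_entry:
  "i \<in> {1..n} \<Longrightarrow> j \<in> {1..n} \<Longrightarrow>
    mat_unit n D s t a (i, j) = (if i = s \<and> j = t then a else \<zero>\<^bsub>D\<^esub>)"
  by (simp add: mat_unit_def)

section \<open>Ring axioms for matrices\<close>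

context ring
begin

lemma mat_mult_closed:
  assumes "A \<in> carrier (mat_ring n R)" "B \<in> carrier (mat_ring n R)"
  shows "A \<otimes>\<^bsub>mat_ring n R\<^esub> B \<in> carrier (mat_ring n R)"
proof -
  note cl = assms[THEN mat_entry_closed]
  have "(\<Oplus>l\<in>{1..n}. A (i, l) \<otimes> B (l, j)) \<in> carrier R" if "i \<in> {1..n}" "j \<in> {1..n}" for i j
    using that cl by (intro finsum_closed) simp
  then show ?thesis by (auto simp: mat_ring_def)
qed

lemma mat_add_closed:
  assumes "A \<in> carrier (mat_ring n R)" "B \<in> carrier (mat_ring n R)"
  shows "A \<oplus>\<^bsub>mat_ring n R\<^esub> B \<in> carrier (mat_ring n R)"
  using assms[THEN mat_entry_closed] by (auto simp: mat_ring_def)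

lemma mat_zero_closed: "\<zero>\<^bsub>mat_ring n R\<^esub> \<in> carrier (mat_ring n R)"
  by (auto simp: mat_ring_def)

lemma mat_one_closed: "\<one>\<^bsub>mat_ring n R\<^esub> \<in> carrier (mat_ring n R)"
  by (auto simp: mat_ring_def)

lemma mat_unit_closed: "a \<in> carrier R \<Longrightarrow> mat_unit n R s t a \<in> carrier (mat_ring n R)"
  by (auto simp: mat_ring_def mat_unit_def)

text \<open>Distributivity turns either bracketing into a double sum of
  \<open>A (i, m) \<otimes> (B (m, l) \<otimes> C (l, j))\<close>; the two differ only in the order
  of summation.\<close>

lemma mat_mult_assoc:
  assumes A: "A \<in> carrier (mat_ring n R)" and B: "B \<in> carrier (mat_ring n R)"
    and C: "C \<in> carrier (mat_ring n R)"
  shows "A \<otimes>\<^bsub>mat_ring n R\<^esub> B \<otimes>\<^bsub>mat_ring n R\<^esub> C = A \<otimes>\<^bsub>mat_ring n R\<^esub> (B \<otimes>\<^bsub>mat_ring n R\<^esub> C)"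
proof (rule mat_eqI)
  fix i j assume ij: "i \<in> {1..n}" "j \<in> {1..n}"
  note cl = A[THEN mat_entry_closed] B[THEN mat_entry_closed] C[THEN mat_entry_closed]
  have "(A \<otimes>\<^bsub>mat_ring n R\<^esub> B \<otimes>\<^bsub>mat_ring n R\<^esub> C) (i, j)
      = (\<Oplus>l\<in>{1..n}. (\<Oplus>m\<in>{1..n}. A (i, m) \<otimes> B (m, l)) \<otimes> C (l, j))"
    using ij cl unfolding mat_mult_entry[OF ij]
    by (intro finsum_cong') (auto simp: mat_mult_entry intro!: finsum_closed)
  also have "\<dots> = (\<Oplus>l\<in>{1..n}. \<Oplus>m\<in>{1..n}. A (i, m) \<otimes> (B (m, l) \<otimes> C (l, j)))"
  proof (intro finsum_cong')
    fix l assume l: "l \<in> {1..n}"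
    have "(\<Oplus>m\<in>{1..n}. A (i, m) \<otimes> B (m, l)) \<otimes> C (l, j)
        = (\<Oplus>m\<in>{1..n}. A (i, m) \<otimes> B (m, l) \<otimes> C (l, j))"
      using ij l cl by (intro finsum_ldistr) auto
    also have "\<dots> = (\<Oplus>m\<in>{1..n}. A (i, m) \<otimes> (B (m, l) \<otimes> C (l, j)))"
      using ij l cl by (intro finsum_cong') (auto simp: m_assoc)
    finally show "(\<Oplus>m\<in>{1..n}. A (i, m) \<otimes> B (m, l)) \<otimes> C (l, j)
        = (\<Oplus>m\<in>{1..n}. A (i, m) \<otimes> (B (m, l) \<otimes> C (l, j)))" .
  qed (use ij cl in \<open>auto intro!: finsum_closed\<close>)
  also have "\<dots> = (\<Oplus>m\<in>{1..n}. \<Oplus>l\<in>{1..n}. A (i, m) \<otimes> (B (m, l) \<otimes> C (l, j)))"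
    using ij cl by (intro finsum_swap) auto
  also have "\<dots> = (\<Oplus>m\<in>{1..n}. A (i, m) \<otimes> (\<Oplus>l\<in>{1..n}. B (m, l) \<otimes> C (l, j)))"
    using ij cl by (intro finsum_cong' finsum_rdistr[symmetric]) (auto intro!: finsum_closed)
  also have "\<dots> = (A \<otimes>\<^bsub>mat_ring n R\<^esub> (B \<otimes>\<^bsub>mat_ring n R\<^esub> C)) (i, j)"
    using ij cl unfolding mat_mult_entry[OF ij]
    by (intro finsum_cong') (auto simp: mat_mult_entry intro!: finsum_closed)
  finally show "(A \<otimes>\<^bsub>mat_ring n R\<^esub> B \<otimes>\<^bsub>mat_ring n R\<^esub> C) (i, j)
      = (A \<otimes>\<^bsub>mat_ring n R\<^esub> (B \<otimes>\<^bsub>mat_ring n R\<^esub> C)) (i, j)" .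
qed (use assms in \<open>auto intro!: mat_mult_closed\<close>)

lemma mat_unit_mult_entry:
  assumes "A \<in> carrier (mat_ring n R)" "a \<in> carrier R" "t \<in> {1..n}" "i \<in> {1..n}" "j \<in> {1..n}"
  shows "(mat_unit n R s t a \<otimes>\<^bsub>mat_ring n R\<^esub> A) (i, j) = (if i = s then a \<otimes> A (t, j) else \<zero>)"
proof -
  \<comment> \<open>Only the summand \<open>l = t\<close> survives; testing \<open>t = l\<close>
    outermost gives the sum the shape that \<open>finsum_singleton\<close> collapses.\<close>
  have "(mat_unit n R s t a \<otimes>\<^bsub>mat_ring n R\<^esub> A) (i, j)
      = (\<Oplus>l\<in>{1..n}. if t = l then (if i = s then a \<otimes> A (l, j) else \<zero>) else \<zero>)"
    using assms assms(1)[THEN mat_entry_closed]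
    by (subst mat_mult_entry, simp, simp, intro finsum_cong') (auto simp: mat_unit_entry)
  also have "\<dots> = (if i = s then a \<otimes> A (t, j) else \<zero>)"
    using assms assms(1)[THEN mat_entry_closed] by (subst finsum_singleton) auto
  finally show ?thesis .
qed

lemma mult_mat_unit_entry:
  assumes "A \<in> carrier (mat_ring n R)" "a \<in> carrier R" "s \<in> {1..n}" "i \<in> {1..n}" "j \<in> {1..n}"
  shows "(A \<otimes>\<^bsub>mat_ring n R\<^esub> mat_unit n R s t a) (i, j) = (if j = t then A (i, s) \<otimes> a else \<zero>)"
proof -
  have "(A \<otimes>\<^bsub>mat_ring n R\<^esub> mat_unit n R s t a) (i, j)
      = (\<Oplus>l\<in>{1..n}. if s = l then (if j = t then A (i, l) \<otimes> a else \<zero>) else \<zero>)"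
    using assms assms(1)[THEN mat_entry_closed]
    by (subst mat_mult_entry, simp, simp, intro finsum_cong') (auto simp: mat_unit_entry)
  also have "\<dots> = (if j = t then A (i, s) \<otimes> a else \<zero>)"
    using assms assms(1)[THEN mat_entry_closed] by (subst finsum_singleton) auto
  finally show ?thesis .
qed

lemma ring_mat_ring: "ring (mat_ring n R)"
proof (rule ringI)
  show "abelian_group (mat_ring n R)"
  proof (rule abelian_groupI)
    fix A assume A: "A \<in> carrier (mat_ring n R)"
    define B where "B = (\<lambda>(i, j) \<in> {1..n} \<times> {1..n}. \<ominus> A (i, j))"
    have B: "B \<in> carrier (mat_ring n R)"
      using A by (auto simp: B_def mat_ring_def)
    have "B \<oplus>\<^bsub>mat_ring n R\<^esub> A = \<zero>\<^bsub>mat_ring n R\<^esub>"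
      using A[THEN mat_entry_closed]
      by (intro mat_eqI[where n = n and D = R] mat_add_closed mat_zero_closed A B)
        (simp add: B_def mat_add_entry mat_zero_entry l_neg)
    with B show "\<exists>B\<in>carrier (mat_ring n R). B \<oplus>\<^bsub>mat_ring n R\<^esub> A = \<zero>\<^bsub>mat_ring n R\<^esub>" by blast
    show "\<zero>\<^bsub>mat_ring n R\<^esub> \<oplus>\<^bsub>mat_ring n R\<^esub> A = A"
      using A[THEN mat_entry_closed]
      by (intro mat_eqI[where n = n and D = R] mat_add_closed mat_zero_closed A)
        (auto simp: mat_add_entry mat_zero_entry mat_entry_closed)
  next
    fix A B C
    assume *: "A \<in> carrier (mat_ring n R)" "B \<in> carrier (mat_ring n R)" "C \<in> carrier (mat_ring n R)"
    note cl = *[THEN mat_entry_closed]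
    show "A \<oplus>\<^bsub>mat_ring n R\<^esub> B \<oplus>\<^bsub>mat_ring n R\<^esub> C = A \<oplus>\<^bsub>mat_ring n R\<^esub> (B \<oplus>\<^bsub>mat_ring n R\<^esub> C)"
      using cl by (intro mat_eqI[where n = n and D = R] mat_add_closed *) (simp add: mat_add_entry a_assoc)
  next
    fix A B
    assume *: "A \<in> carrier (mat_ring n R)" "B \<in> carrier (mat_ring n R)"
    note cl = *[THEN mat_entry_closed]
    show "A \<oplus>\<^bsub>mat_ring n R\<^esub> B = B \<oplus>\<^bsub>mat_ring n R\<^esub> A"
      using cl by (intro mat_eqI[where n = n and D = R] mat_add_closed *) (simp add: mat_add_entry a_comm)
  qed (auto intro: mat_add_closed mat_zero_closed)
  show "monoid (mat_ring n R)"
  proof (rule monoidI)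
    fix A assume A: "A \<in> carrier (mat_ring n R)"
    note cl = A[THEN mat_entry_closed]
    show "\<one>\<^bsub>mat_ring n R\<^esub> \<otimes>\<^bsub>mat_ring n R\<^esub> A = A"
    proof (intro mat_eqI[where n = n and D = R] mat_mult_closed mat_one_closed A)
      fix i j assume ij: "i \<in> {1..n}" "j \<in> {1..n}"
      have "(\<one>\<^bsub>mat_ring n R\<^esub> \<otimes>\<^bsub>mat_ring n R\<^esub> A) (i, j) = (\<Oplus>l\<in>{1..n}. if i = l then A (l, j) else \<zero>)"
        unfolding mat_mult_entry[OF ij] using ij cl
        by (intro finsum_cong') (auto simp: mat_one_entry)
      then show "(\<one>\<^bsub>mat_ring n R\<^esub> \<otimes>\<^bsub>mat_ring n R\<^esub> A) (i, j) = A (i, j)"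
        using ij cl by (subst (asm) finsum_singleton) auto
    qed
    show "A \<otimes>\<^bsub>mat_ring n R\<^esub> \<one>\<^bsub>mat_ring n R\<^esub> = A"
    proof (intro mat_eqI[where n = n and D = R] mat_mult_closed mat_one_closed A)
      fix i j assume ij: "i \<in> {1..n}" "j \<in> {1..n}"
      have "(A \<otimes>\<^bsub>mat_ring n R\<^esub> \<one>\<^bsub>mat_ring n R\<^esub>) (i, j) = (\<Oplus>l\<in>{1..n}. if j = l then A (i, l) else \<zero>)"
        unfolding mat_mult_entry[OF ij] using ij cl
        by (intro finsum_cong') (auto simp: mat_one_entry)
      then show "(A \<otimes>\<^bsub>mat_ring n R\<^esub> \<one>\<^bsub>mat_ring n R\<^esub>) (i, j) = A (i, j)"
        using ij cl by (subst (asm) finsum_singleton) auto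
    qed
  qed (auto intro: mat_mult_closed mat_one_closed mat_mult_assoc)
next
  fix A B C
  assume *: "A \<in> carrier (mat_ring n R)" "B \<in> carrier (mat_ring n R)" "C \<in> carrier (mat_ring n R)"
  note cl = *[THEN mat_entry_closed]
  show "(A \<oplus>\<^bsub>mat_ring n R\<^esub> B) \<otimes>\<^bsub>mat_ring n R\<^esub> C
      = A \<otimes>\<^bsub>mat_ring n R\<^esub> C \<oplus>\<^bsub>mat_ring n R\<^esub> B \<otimes>\<^bsub>mat_ring n R\<^esub> C"
  proof (intro mat_eqI[where n = n and D = R] mat_mult_closed mat_add_closed *)
    fix i j assume ij: "i \<in> {1..n}" "j \<in> {1..n}"
    have "((A \<oplus>\<^bsub>mat_ring n R\<^esub> B) \<otimes>\<^bsub>mat_ring n R\<^esub> C) (i, j)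
        = (\<Oplus>l\<in>{1..n}. A (i, l) \<otimes> C (l, j) \<oplus> B (i, l) \<otimes> C (l, j))"
      unfolding mat_mult_entry[OF ij] using ij cl
      by (intro finsum_cong') (auto simp: mat_add_entry l_distr)
    also have "\<dots> = (A \<otimes>\<^bsub>mat_ring n R\<^esub> C \<oplus>\<^bsub>mat_ring n R\<^esub> B \<otimes>\<^bsub>mat_ring n R\<^esub> C) (i, j)"
      unfolding mat_mult_entry[OF ij] mat_add_entry[OF ij] using ij cl
      by (intro finsum_addf) auto
    finally show "((A \<oplus>\<^bsub>mat_ring n R\<^esub> B) \<otimes>\<^bsub>mat_ring n R\<^esub> C) (i, j)
        = (A \<otimes>\<^bsub>mat_ring n R\<^esub> C \<oplus>\<^bsub>mat_ring n R\<^esub> B \<otimes>\<^bsub>mat_ring n R\<^esub> C) (i, j)" .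
  qed
  show "C \<otimes>\<^bsub>mat_ring n R\<^esub> (A \<oplus>\<^bsub>mat_ring n R\<^esub> B)
      = C \<otimes>\<^bsub>mat_ring n R\<^esub> A \<oplus>\<^bsub>mat_ring n R\<^esub> C \<otimes>\<^bsub>mat_ring n R\<^esub> B"
  proof (intro mat_eqI[where n = n and D = R] mat_mult_closed mat_add_closed *)
    fix i j assume ij: "i \<in> {1..n}" "j \<in> {1..n}"
    have "(C \<otimes>\<^bsub>mat_ring n R\<^esub> (A \<oplus>\<^bsub>mat_ring n R\<^esub> B)) (i, j)
        = (\<Oplus>l\<in>{1..n}. C (i, l) \<otimes> A (l, j) \<oplus> C (i, l) \<otimes> B (l, j))"
      unfolding mat_mult_entry[OF ij] using ij cl
      by (intro finsum_cong') (auto simp: mat_add_entry r_distr)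
    also have "\<dots> = (C \<otimes>\<^bsub>mat_ring n R\<^esub> A \<oplus>\<^bsub>mat_ring n R\<^esub> C \<otimes>\<^bsub>mat_ring n R\<^esub> B) (i, j)"
      unfolding mat_mult_entry[OF ij] mat_add_entry[OF ij] using ij cl
      by (intro finsum_addf) auto
    finally show "(C \<otimes>\<^bsub>mat_ring n R\<^esub> (A \<oplus>\<^bsub>mat_ring n R\<^esub> B)) (i, j)
        = (C \<otimes>\<^bsub>mat_ring n R\<^esub> A \<oplus>\<^bsub>mat_ring n R\<^esub> C \<otimes>\<^bsub>mat_ring n R\<^esub> B) (i, j)" .
  qed
qed

end

text \<open>Left multiplication by \<open>E\<^sub>1\<^sub>s\<close> moves row \<open>s\<close> into
  the first row, and right multiplication by \<open>E\<^sub>s\<^sub>1\<close> moves column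
  \<open>s\<close> into the first column, so vanishing can be tested there. The corner at
  \<open>(1, 1)\<close> is a copy of \<open>D\<close>, where nonzero elements are
  invertible.\<close>

lemma matrix_units_mat_ring:
  assumes D: "skew_field D" and n: "1 \<le> n"
  shows "matrix_units (mat_ring n D) {1..n} (\<lambda>s. mat_unit n D 1 s \<one>\<^bsub>D\<^esub>)
    (\<lambda>s. mat_unit n D s 1 \<one>\<^bsub>D\<^esub>) (mat_unit n D 1 1 \<one>\<^bsub>D\<^esub>)"
proof -
  interpret ring D using D by (simp add: skew_field_def)
  have 1: "1 \<in> {1..n}" using n by simp
  note entries = mat_unit_mult_entry mult_mat_unit_entry mat_unit_entry mat_zero_entry
    mat_unit_closed mat_mult_closed mat_zero_closed mat_entry_closed
  interpret M: ring "mat_ring n D" by (rule ring_mat_ring)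
  show ?thesis
  proof unfold_locales
    fix Y assume Y: "Y \<in> carrier (mat_ring n D)"
    show "Y = \<zero>\<^bsub>mat_ring n D\<^esub>"
      if *: "\<And>s. s \<in> {1..n} \<Longrightarrow> mat_unit n D 1 s \<one>\<^bsub>D\<^esub> \<otimes>\<^bsub>mat_ring n D\<^esub> Y = \<zero>\<^bsub>mat_ring n D\<^esub>"
    proof (rule mat_eqI[OF Y mat_zero_closed])
      fix i j assume ij: "i \<in> {1..n}" "j \<in> {1..n}"
      have "(mat_unit n D 1 i \<one>\<^bsub>D\<^esub> \<otimes>\<^bsub>mat_ring n D\<^esub> Y) (1, j) = Y (i, j)"
        using Y ij 1 mat_entry_closed[OF Y ij] by (subst mat_unit_mult_entry) auto
      then show "Y (i, j) = \<zero>\<^bsub>mat_ring n D\<^esub> (i, j)" using *[OF ij(1)] ij 1 by (simp add: mat_zero_entry)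
    qed
    show "Y = \<zero>\<^bsub>mat_ring n D\<^esub>"
      if *: "\<And>s. s \<in> {1..n} \<Longrightarrow> Y \<otimes>\<^bsub>mat_ring n D\<^esub> mat_unit n D s 1 \<one>\<^bsub>D\<^esub> = \<zero>\<^bsub>mat_ring n D\<^esub>"
    proof (rule mat_eqI[OF Y mat_zero_closed])
      fix i j assume ij: "i \<in> {1..n}" "j \<in> {1..n}"
      have "(Y \<otimes>\<^bsub>mat_ring n D\<^esub> mat_unit n D j 1 \<one>\<^bsub>D\<^esub>) (i, 1) = Y (i, j)"
        using Y ij 1 mat_entry_closed[OF Y ij] by (subst mult_mat_unit_entry) auto
      then show "Y (i, j) = \<zero>\<^bsub>mat_ring n D\<^esub> (i, j)" using *[OF ij(2)] ij 1 by (simp add: mat_zero_entry)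
    qed
    assume Y0: "Y \<noteq> \<zero>\<^bsub>mat_ring n D\<^esub>"
      and eY: "mat_unit n D 1 1 \<one>\<^bsub>D\<^esub> \<otimes>\<^bsub>mat_ring n D\<^esub> Y = Y"
      and Ye: "Y \<otimes>\<^bsub>mat_ring n D\<^esub> mat_unit n D 1 1 \<one>\<^bsub>D\<^esub> = Y"
    define a where "a = Y (1, 1)"
    have a: "a \<in> carrier D" using mat_entry_closed[OF Y 1 1] by (simp add: a_def)
    \<comment> \<open>Invariance under \<open>E\<^sub>1\<^sub>1\<close> on both sides confines
      \<open>Y\<close> to the entry \<open>(1, 1)\<close>, so \<open>Y\<close> is nonzero only if
      the scalar \<open>a\<close> is.\<close>
    have Yij: "Y (i, j) = (if i = 1 \<and> j = 1 then a else \<zero>\<^bsub>D\<^esub>)" if "i \<in> {1..n}" "j \<in> {1..n}" for i j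
      using mat_unit_mult_entry[OF Y one_closed 1 that, of 1]
        mult_mat_unit_entry[OF Y one_closed 1 that, of 1] eY Ye by (auto simp: a_def)
    then have "a \<noteq> \<zero>\<^bsub>D\<^esub>"
      using Y0 mat_eqI[OF Y mat_zero_closed] by (auto simp: mat_zero_entry)
    then have "a \<in> Units D" using D a by (simp add: skew_field_def)
    then obtain a' where a': "a' \<in> carrier D" "a \<otimes>\<^bsub>D\<^esub> a' = \<one>\<^bsub>D\<^esub>"
      by (auto simp: Units_def)
    \<comment> \<open>The inverse scalar \<open>a'\<close>, placed at \<open>(1, 1)\<close>, is the
      inverse required in the corner.\<close>
    have "mat_unit n D 1 1 a' \<otimes>\<^bsub>mat_ring n D\<^esub> mat_unit n D 1 1 \<one>\<^bsub>D\<^esub> = mat_unit n D 1 1 a'"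
      using a' 1 by (intro mat_eqI[where n = n and D = D]) (auto simp: entries)
    moreover have "Y \<otimes>\<^bsub>mat_ring n D\<^esub> mat_unit n D 1 1 a' = mat_unit n D 1 1 \<one>\<^bsub>D\<^esub>"
      using Y a' 1 by (intro mat_eqI[where n = n and D = D]) (auto simp: entries Yij)
    ultimately show "\<exists>d'\<in>carrier (mat_ring n D).
        d' \<otimes>\<^bsub>mat_ring n D\<^esub> mat_unit n D 1 1 \<one>\<^bsub>D\<^esub> = d' \<and>
        Y \<otimes>\<^bsub>mat_ring n D\<^esub> d' = mat_unit n D 1 1 \<one>\<^bsub>D\<^esub>"
      using a' mat_unit_closed by blast
  next
    fix s t assume "s \<in> {1..n}" "t \<in> {1..n}"
    then show "mat_unit n D 1 s \<one>\<^bsub>D\<^esub> \<otimes>\<^bsub>mat_ring n D\<^esub> mat_unit n D t 1 \<one>\<^bsub>D\<^esub> =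
        (if s = t then mat_unit n D 1 1 \<one>\<^bsub>D\<^esub> else \<zero>\<^bsub>mat_ring n D\<^esub>)"
      using 1 by (intro mat_eqI[where n = n and D = D]) (auto simp: entries)
  qed (use 1 in \<open>auto intro!: mat_eqI simp: entries\<close>)
qed

section \<open>Direct products\<close>

context ring
begin

lemma sharp_subset_carrier: "carrier (sharp R) \<subseteq> carrier R"
  using submonoid_sharp[OF ring_axioms] by (simp add: submonoid_def)

lemma idempotents_subset_sharp: "idempotents R \<subseteq> carrier (sharp R)"
proof
  fix x assume "x \<in> idempotents R"
  then have x: "x \<in> carrier R" "x \<otimes> x = x" by (auto simp: idempotents_def)
  have "left_zero_divisor R x \<and> right_zero_divisor R x" if "x \<noteq> \<one>"
  proof -
    have "\<one> \<ominus> x \<noteq> \<zero>" using x that by simp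
    moreover have "x \<otimes> (\<one> \<ominus> x) = \<zero>" using x by (simp add: diff_r_distr diff_self)
    moreover have "(\<one> \<ominus> x) \<otimes> x = \<zero>" using x by (simp add: diff_l_distr diff_self)
    moreover have "\<one> \<ominus> x \<in> carrier R" using x by simp
    ultimately show ?thesis
      using x unfolding left_zero_divisor_def right_zero_divisor_def by blast
  qed
  then show "x \<in> carrier (sharp R)" by (auto simp: sharp_def)
qed

lemma idempotents_sharp: "idempotents (sharp R) = idempotents R"
  using idempotents_subset_sharp sharp_subset_carrier
  by (auto simp: idempotents_def sharp_def)

text \<open>\<open>sharp R\<close> has the operations of \<open>R\<close> and contains all its
  idempotents, so lengths in \<open>R\<^sub>i\<^sup>#\<close> may be computed in the full matrix
  ring.\<close>

lemma idempotent_factorizations_sharp: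
  "idempotent_factorizations (sharp R) x = idempotent_factorizations R x"
  unfolding idempotent_factorizations_def idempotents_sharp by (simp add: sharp_def)

end

lemma idempotent_length_le_iff:
  "idempotent_length M x \<le> enat m \<longleftrightarrow> (\<exists>es\<in>idempotent_factorizations M x. length es \<le> m)"
proof
  assume le: "idempotent_length M x \<le> enat m"
  let ?L = "(\<lambda>es. enat (length es)) ` idempotent_factorizations M x"
  \<comment> \<open>An infimum over the empty set would be \<infinity>, which is not below any
    \<open>enat m\<close>.\<close>
  have "?L \<noteq> {}"
  proof
    assume "?L = {}"
    with le show False by (simp add: idempotent_length_def top_enat_def)
  qed
  \<comment> \<open>By well-ordering, a nonempty set of extended naturals attains its
    infimum.\<close>
  then have "Inf ?L \<in> ?L"
    unfolding Inf_enat_def by (auto intro: LeastI)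
  with le show "\<exists>es\<in>idempotent_factorizations M x. length es \<le> m"
    unfolding idempotent_length_def by auto
next
  assume "\<exists>es\<in>idempotent_factorizations M x. length es \<le> m"
  then show "idempotent_length M x \<le> enat m"
    unfolding idempotent_length_def by (auto intro: INF_lower2)
qed

lemma idempotent_factorization_imp_generated:
  assumes "es \<in> idempotent_factorizations M x"
  shows "x \<in> idempotent_generated M"
proof -
  have "foldr (\<otimes>\<^bsub>M\<^esub>) es \<one>\<^bsub>M\<^esub> \<in> H" if H: "submonoid H M" "idempotents M \<subseteq> H" for H
  proof -
    have "set es \<subseteq> H" using assms H by (auto simp: idempotent_factorizations_def)
    then show ?thesis
      by (induction es) (auto intro: submonoid.m_closed[OF H(1)] submonoid.one_closed[OF H(1)])
  qed
  with assms show ?thesis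
    by (auto simp: idempotent_generated_def idempotent_factorizations_def)
qed

text \<open>Applied to the inverse of \<open>\<phi>\<close>, this carries factorizations from the
  product back to \<open>R\<close> without changing their length.\<close>

lemma (in monoid) idempotent_factorization_hom:
  assumes h: "h \<in> hom G N" "h \<one> = \<one>\<^bsub>N\<^esub>"
    and es: "es \<in> idempotent_factorizations G x"
  shows "map h es \<in> idempotent_factorizations N (h x)"
proof -
  have idem: "set es \<subseteq> idempotents G" and x: "foldr (\<otimes>) es \<one> = x"
    using es by (simp_all add: idempotent_factorizations_def)
  have "set es \<subseteq> carrier G" using idem idempotents_subset_carrier by (rule order_trans)
  then have "foldr (\<otimes>\<^bsub>N\<^esub>) (map h es) \<one>\<^bsub>N\<^esub> = h (foldr (\<otimes>) es \<one>)"
  proof (induction es)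
    case Nil
    then show ?case using h(2) by simp
  next
    case (Cons a es)
    then show ?case using hom_mult[OF h(1), of a] foldr_mult_closed[of es] by simp
  qed
  moreover have "h a \<in> idempotents N" if "a \<in> idempotents G" for a
    using that h(1) hom_mult[OF h(1), of a a] hom_in_carrier[OF h(1), of a]
    by (simp add: idempotents_def)
  then have "set (map h es) \<subseteq> idempotents N" using idem by auto
  ultimately show ?thesis using x by (simp add: idempotent_factorizations_def)
qed

section \<open>Componentwise factorization and transfer along the isomorphism\<close>

lemma monoid_product_ring:
  assumes "\<And>i. i \<in> I \<Longrightarrow> monoid (M i)"
  shows "monoid (product_ring I M)"
  using assms unfolding product_ring_def
  by (intro monoidI) (auto simp: PiE_iff extensional_def restrict_def monoid.m_assoc
      monoid.m_closed monoid.one_closed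
      monoid.l_one monoid.r_one fun_eq_iff)

lemma foldr_product_ring:
  "foldr (\<otimes>\<^bsub>product_ring I M\<^esub>) fs \<one>\<^bsub>product_ring I M\<^esub>
    = (\<lambda>i\<in>I. foldr (\<otimes>\<^bsub>M i\<^esub>) (map (\<lambda>f. f i) fs) \<one>\<^bsub>M i\<^esub>)"
  by (induction fs) (auto simp: product_ring_def fun_eq_iff)

lemma idempotent_product_ring_iff:
  "f \<in> idempotents (product_ring I M) \<longleftrightarrow>
    f \<in> extensional I \<and> (\<forall>i\<in>I. f i \<in> idempotents (M i))"
  by (auto simp: idempotents_def product_ring_def PiE_iff fun_eq_iff extensional_def)

lemma product_ring_factorization:
  assumes M: "\<And>i. i \<in> I \<Longrightarrow> monoid (M i)" and x: "x \<in> extensional I"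
    and fact: "\<And>i. i \<in> I \<Longrightarrow> \<exists>es\<in>idempotent_factorizations (M i) (x i). length es \<le> m"
  shows "\<exists>fs\<in>idempotent_factorizations (product_ring I M) x. length fs \<le> m"
proof -
  \<comment> \<open>Padding with ones makes all component lists exactly \<open>m\<close> long, so
    that they can be combined position by position.\<close>
  have "\<exists>es\<in>idempotent_factorizations (M i) (x i). length es = m" if i: "i \<in> I" for i
  proof -
    interpret monoid "M i" using M i .
    obtain es where es: "es \<in> idempotent_factorizations (M i) (x i)" "length es \<le> m"
      using fact i by blast
    let ?ones = "replicate (m - length es) \<one>\<^bsub>M i\<^esub>"
    have "foldr (\<otimes>\<^bsub>M i\<^esub>) (replicate j \<one>\<^bsub>M i\<^esub>) \<one>\<^bsub>M i\<^esub> = \<one>\<^bsub>M i\<^esub>" for j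
      by (induction j) auto
    then have "es @ ?ones \<in> idempotent_factorizations (M i) (x i)"
      using es(1) by (auto simp: idempotent_factorizations_def idempotents_def)
    moreover have "length (es @ ?ones) = m" using es(2) by simp
    ultimately show ?thesis by blast
  qed
  then obtain es where es: "\<And>i. i \<in> I \<Longrightarrow> es i \<in> idempotent_factorizations (M i) (x i)"
    and len: "\<And>i. i \<in> I \<Longrightarrow> length (es i) = m"
    by metis
  \<comment> \<open>A transposition: the factor at position \<open>k\<close> collects the factors at
    position \<open>k\<close> of all components.\<close>
  define fs where "fs = map (\<lambda>k. \<lambda>i\<in>I. es i ! k) [0..<m]"
  have comp: "map (\<lambda>f. f i) fs = es i" if "i \<in> I" for i
    using that len by (intro nth_equalityI) (auto simp: fs_def)
  have "es i ! k \<in> idempotents (M i)" if "i \<in> I" "k < m" for i k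
    using es[OF that(1)] len[OF that(1)] that(2) nth_mem[of k "es i"]
    by (auto simp: idempotent_factorizations_def)
  then have "set fs \<subseteq> idempotents (product_ring I M)"
    by (auto simp: fs_def idempotent_product_ring_iff)
  moreover have "foldr (\<otimes>\<^bsub>product_ring I M\<^esub>) fs \<one>\<^bsub>product_ring I M\<^esub> = x"
    unfolding foldr_product_ring using es comp x
    by (auto simp: fun_eq_iff idempotent_factorizations_def extensional_def)
  ultimately have "fs \<in> idempotent_factorizations (product_ring I M) x"
    by (simp add: idempotent_factorizations_def)
  moreover have "length fs \<le> m" by (simp add: fs_def)
  ultimately show ?thesis by blast
qed

lemma idempotent_factorization_via_product:
  assumes R: "ring R" and M: "\<And>i. i \<in> I \<Longrightarrow> ring (M i)"
    and \<phi>: "\<phi> \<in> ring_iso R (product_ring I M)" and x: "x \<in> carrier R"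
    and fact: "\<And>i. i \<in> I \<Longrightarrow> \<exists>es\<in>idempotent_factorizations (M i) (\<phi> x i). length es \<le> m"
  shows "\<exists>es\<in>idempotent_factorizations R x. length es \<le> m"
proof -
  let ?\<psi> = "inv_into (carrier R) \<phi>"
  have mon: "\<And>i. i \<in> I \<Longrightarrow> monoid (M i)"
    using M ring.is_monoid by blast
  have "\<phi> x \<in> extensional I"
    using ring_iso_memE(1)[OF \<phi> x] by (auto simp: product_ring_def PiE_iff)
  then obtain fs where fs: "fs \<in> idempotent_factorizations (product_ring I M) (\<phi> x)" "length fs \<le> m"
    using product_ring_factorization[of I M "\<phi> x" m, OF mon _ fact] by auto
  have \<psi>: "?\<psi> \<in> ring_iso (product_ring I M) R"
    using ring_iso_set_sym[OF R \<phi>] .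
  interpret monoid "product_ring I M" using monoid_product_ring[OF mon] .
  have "map ?\<psi> fs \<in> idempotent_factorizations R (?\<psi> (\<phi> x))"
    using ring_iso_memE(1,2,4)[OF \<psi>]
    by (intro idempotent_factorization_hom fs(1)) (auto simp: hom_def)
  moreover have "?\<psi> (\<phi> x) = x"
    using ring_iso_memE(5)[OF \<phi>] x by (simp add: bij_betw_def inv_into_f_f)
  ultimately show ?thesis using fs(2) by (intro bexI[of _ "map ?\<psi> fs"]) auto
qed

text \<open>The generated submonoid is the least one containing the idempotents, so it suffices that
  the preimage under \<open>\<phi>\<close> of the product of the monoids \<open>sharp (M i)\<close>
  is a submonoid containing them.\<close>

lemma idempotent_generated_subset_sharp:
  assumes R: "ring R" and M: "\<And>i. i \<in> I \<Longrightarrow> ring (M i)"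
    and \<phi>: "\<phi> \<in> ring_iso R (product_ring I M)"
  shows "\<phi> ` idempotent_generated R \<subseteq> (\<Pi>\<^sub>E i\<in>I. carrier (sharp (M i)))"
proof -
  interpret ring R by (rule R)
  define H where "H = {x \<in> carrier R. \<phi> x \<in> (\<Pi>\<^sub>E i\<in>I. carrier (sharp (M i)))}"
  note iso = ring_iso_memE[OF \<phi>]
  have sub: "submonoid (carrier (sharp (M i))) (M i)" if "i \<in> I" for i
    using submonoid_sharp[OF M[OF that]] .
  have "submonoid H R"
  proof
    show "x \<otimes>\<^bsub>R\<^esub> y \<in> H" if "x \<in> H" "y \<in> H" for x y
      using that iso(2)[of x y] submonoid.m_closed[OF sub]
      by (auto simp: H_def product_ring_def PiE_iff)
    show "\<one>\<^bsub>R\<^esub> \<in> H"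
      using iso(4) submonoid.one_closed[OF sub]
      by (auto simp: H_def product_ring_def PiE_iff)
  qed (auto simp: H_def)
  moreover have "idempotents R \<subseteq> H"
  proof
    fix x assume x: "x \<in> idempotents R"
    then have "\<phi> x \<in> idempotents (product_ring I M)"
      using iso(1)[of x] iso(2)[of x x] by (simp add: idempotents_def)
    then show "x \<in> H"
      using x ring.idempotents_subset_sharp[OF M]
      by (auto simp: idempotent_product_ring_iff H_def PiE_iff idempotents_def[of R])
  qed
  ultimately have "idempotent_generated R \<subseteq> H"
    by (auto simp: idempotent_generated_def)
  then show ?thesis by (auto simp: H_def)
qed

text \<open>The identity, adjoined to the zero divisors in \<open>sharp\<close>, is the empty
  product; every other element is a left zero divisor, and rank reduction applies with
  \<open>n\<close> rows.\<close>

lemma mat_ring_sharp_factorization: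
  assumes D: "skew_field D" and n: "1 \<le> n" and x: "x \<in> carrier (sharp (mat_ring n D))"
  shows "\<exists>es\<in>idempotent_factorizations (mat_ring n D) x. length es \<le> n"
proof (cases "x = \<one>\<^bsub>mat_ring n D\<^esub>")
  case True
  then have "[] \<in> idempotent_factorizations (mat_ring n D) x"
    by (simp add: idempotent_factorizations_def)
  then show ?thesis by force
next
  case False
  with x have "left_zero_divisor (mat_ring n D) x" by (simp add: sharp_def)
  then show ?thesis
    using matrix_units.left_zero_divisor_factorization[OF matrix_units_mat_ring[OF D n]] by simp
qed

section \<open>The monoid generated by the idempotents and the length bounds\<close>

theorem mainTheorem7:
  fixes R :: "('r, 'm) ring_scheme"
    and D :: "nat \<Rightarrow> ('d, 'e) ring_scheme"
    and n :: "nat \<Rightarrow> nat" and k :: nat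
    and \<phi> :: "'r \<Rightarrow> nat \<Rightarrow> nat \<times> nat \<Rightarrow> 'd"
  assumes "semisimple_ring R"
    and "1 \<le> k"
    and "\<forall>i\<in>{1..k}. skew_field (D i)"
    and "\<forall>i\<in>{1..k}. 1 \<le> n i"
    and "\<forall>i\<in>{1..k}. \<forall>j\<in>{1..k}. i \<le> j \<longrightarrow> n i \<le> n j"
    and "\<phi> \<in> ring_iso R (product_ring {1..k} (\<lambda>i. mat_ring (n i) (D i)))"
  shows "\<phi> ` idempotent_generated R = (\<Pi>\<^sub>E i\<in>{1..k}. carrier (sharp (mat_ring (n i) (D i)))) \<and>
    (\<forall>x\<in>carrier R. \<phi> x \<in> (\<Pi>\<^sub>E i\<in>{1..k}. carrier (sharp (mat_ring (n i) (D i)))) \<longrightarrow>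
      (\<forall>i\<in>{1..k}. idempotent_length (sharp (mat_ring (n i) (D i))) (\<phi> x i) \<noteq> \<infinity>) \<and>
      idempotent_length R x
        \<le> (MAX i\<in>{1..k}. idempotent_length (sharp (mat_ring (n i) (D i))) (\<phi> x i)) \<and>
      idempotent_length R x \<le> enat (MAX i\<in>{1..k}. n i)) \<and>
    (MAX i\<in>{1..k}. n i) = n k"
proof -
  let ?M = "\<lambda>i. mat_ring (n i) (D i)"
  let ?X = "\<Pi>\<^sub>E i\<in>{1..k}. carrier (sharp (?M i))"
  note \<phi> = assms(6)
  have R: "ring R" using assms(1) by (simp add: semisimple_ring_def)
  have M: "ring (?M i)" if "i \<in> {1..k}" for i
    using assms(3) that by (intro ring.ring_mat_ring) (auto simp: skew_field_def)
  have max: "(MAX i\<in>{1..k}. n i) = n k"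
    using assms(2,5) by (intro Max_eqI) auto
  \<comment> \<open>As the largest size, \<open>n k\<close> bounds suitable factorizations in all
    components at once; a common bound is what the product construction asks for.\<close>
  have comp: "\<exists>es\<in>idempotent_factorizations (?M i) (y i). length es \<le> n k"
    if y: "y \<in> ?X" and i: "i \<in> {1..k}" for y i
  proof -
    have "y i \<in> carrier (sharp (?M i))" using y i by auto
    then obtain es where "es \<in> idempotent_factorizations (?M i) (y i)" "length es \<le> n i"
      using mat_ring_sharp_factorization[of "D i" "n i" "y i"] assms(3,4) i by blast
    moreover have "n i \<le> n k" using assms(2,5) i by auto
    ultimately show ?thesis by (meson order_trans)
  qed
  have gen: "\<phi> ` idempotent_generated R = ?X"
  proof
    show "\<phi> ` idempotent_generated R \<subseteq> ?X"
      using idempotent_generated_subset_sharp[OF R M \<phi>] .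
    show "?X \<subseteq> \<phi> ` idempotent_generated R"
    proof
      fix y assume y: "y \<in> ?X"
      then have "y \<in> carrier (product_ring {1..k} ?M)"
        using ring.sharp_subset_carrier[OF M] by (fastforce simp: product_ring_def PiE_iff)
      then obtain x where x: "x \<in> carrier R" "y = \<phi> x"
        using ring_iso_memE(5)[OF \<phi>] by (auto simp: bij_betw_def)
      have "\<exists>es\<in>idempotent_factorizations R x. length es \<le> n k"
        by (rule idempotent_factorization_via_product[OF R M \<phi> x(1) comp[OF y, unfolded x(2)]])
      then have "x \<in> idempotent_generated R"
        by (auto intro: idempotent_factorization_imp_generated)
      then show "y \<in> \<phi> ` idempotent_generated R"
        unfolding x(2) by (rule imageI)
    qed
  qed
  have "(\<forall>i\<in>{1..k}. idempotent_length (sharp (?M i)) (\<phi> x i) \<noteq> \<infinity>) \<and>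
      idempotent_length R x \<le> (MAX i\<in>{1..k}. idempotent_length (sharp (?M i)) (\<phi> x i)) \<and>
      idempotent_length R x \<le> enat (n k)"
    if x: "x \<in> carrier R" and X: "\<phi> x \<in> ?X" for x
  proof (intro conjI)
    let ?l = "\<lambda>i. idempotent_length (sharp (?M i)) (\<phi> x i)"
    have l_iff: "?l i \<le> enat m \<longleftrightarrow>
        (\<exists>es\<in>idempotent_factorizations (?M i) (\<phi> x i). length es \<le> m)" if "i \<in> {1..k}" for i m
      using ring.idempotent_factorizations_sharp[OF M[OF that]] by (simp add: idempotent_length_le_iff)
    have le: "?l i \<le> enat (n k)" if "i \<in> {1..k}" for i
      using l_iff[OF that] comp[OF X that] by blast
    then have fin: "?l i \<noteq> \<infinity>" if "i \<in> {1..k}" for i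
      using that by (metis infinity_ileE)
    then show "\<forall>i\<in>{1..k}. ?l i \<noteq> \<infinity>" by blast
    have bound: "idempotent_length R x \<le> enat m" if "\<And>i. i \<in> {1..k} \<Longrightarrow> ?l i \<le> enat m" for m
      unfolding idempotent_length_le_iff
      using that l_iff by (intro idempotent_factorization_via_product[OF R M \<phi> x]) auto
    show "idempotent_length R x \<le> enat (n k)"
      using le by (rule bound)
    \<comment> \<open>Since \<open>1 \<le> k\<close>, the maximum is attained, hence finite like
      every component length. Written as \<open>enat m\<close>, it supplies a natural number to
      which all component factorizations can be padded.\<close>
    have "(MAX i\<in>{1..k}. ?l i) \<in> ?l ` {1..k}"
      using assms(2) by (intro Max_in) auto
    then obtain j where "j \<in> {1..k}" "(MAX i\<in>{1..k}. ?l i) = ?l j" by (rule imageE)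
    then obtain m where m: "(MAX i\<in>{1..k}. ?l i) = enat m" using fin[of j] by auto
    have "?l i \<le> enat m" if "i \<in> {1..k}" for i
      unfolding m[symmetric] using that by (intro Max_ge) auto
    then show "idempotent_length R x \<le> (MAX i\<in>{1..k}. ?l i)"
      unfolding m by (rule bound)
  qed
  then show ?thesis using gen max by simp
qed

end
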